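(* For any $T\in\mathcal T$, $$\bigcup_{z_u\in\mathrm{Per}}B(z_u,w(z_u))\subset\mathbf B(T)\qquad\text{and}\qquad\bigcup_{z_u\in\mathrm{Per}}B(z_u,w(z_u))\subset\mathbf A(T),$$ where $\mathrm{Per}$ is the set of all periodic points $z_u$ of $T$ of some period $n\ge1$ such that $e^{in\alpha}\ne1$.
   Context: Identify $\mathbb R^2$ with $\mathbb C$. Class $\mathcal T$: fix $\alpha\in\mathbb R$ with $e^{i\alpha}\ne1$, $\gamma\in\mathbb R$, and distinct $C_0,C_1\in\mathbb C$. Let $\mathbf D=e^{i\gamma}\mathbb R$ (a line through $0$), let $\mathbf P_0=\{z:\operatorname{Im}(e^{-i\gamma}z)>0\}$ and $\mathbf P_1=\mathbb C\setminus\mathbf P_0$. The associated map $T:\mathbb C\to\mathbb C$ is $T(z)=e^{i\alpha}(z-C_j)+C_j$ if $z\in\mathbf P_j$, $j\in\{0,1\}$; $\mathcal T$ is the set of all such maps. Limit sets: with $B(z,r)$ the open disc of center $z$ and radius $r$, $$\mathbf A(T)=\bigcup_{M>0}\bigcap_{n\ge0}T^n(B(0,M)),\qquad \mathbf B(T)=\bigcup_{M>0}\bigcap_{n\ge0}T^{-n}(B(0,M)),$$ where $T^{-n}$ denotes preimage under $T^n$. Thus $z\in\mathbf B(T)$ iff its forward orbit is bounded, and $z\in\mathbf A(T)$ iff there is a bounded sequence $(y_n)$ with $T^n(y_n)=z$ for all $n$. Periodic points and weights: for a word $u=u_0\dots u_{n-1}\in\{0,1\}^n$ with $n\ge1$ and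 $e^{in\alpha}\neq1$, let $z_u=\frac{1-e^{i\alpha}}{1-e^{in\alpha}}\sum_{k=0}^{n-1}e^{i(n-k-1)\alpha}C_{u_k}$, the unique fixed point of $r_{u_{n-1}}\circ\cdots\circ r_{u_0}$, where $r_j(z)=e^{i\alpha}(z-C_j)+C_j$. It is a periodic point of $T$ of period $n$ (with coding $u$) when $T^k(z_u)\in\mathbf P_{u_k}$ for all $0\le k\le n-1$. Its weight is $w(z_u)=\min\{d(T^k(z_u),\mathbf D):0\le k\le n-1\}$, where $d$ is Euclidean distance. *)

theory Defs
  imports "HOL-Analysis.Analysis"
begin

text \<open>
  The piecewise rotation below depends on the angle \<open>\<alpha>\<close>, the direction \<open>\<gamma>\<close> of the
  discontinuity line and the centres \<open>C 0\<close>, \<open>C 1\<close>.  Only the values of \<open>C\<close> at the letters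
  \<open>0\<close> and \<open>1\<close> are ever used.
\<close>

definition disc_line :: "real \<Rightarrow> complex set" where
  "disc_line \<gamma> = range (\<lambda>t::real. cis \<gamma> * of_real t)"

definition half_plane :: "real \<Rightarrow> nat \<Rightarrow> complex set" where
  "half_plane \<gamma> j =
     (if j = 0 then {z. Im (cis (- \<gamma>) * z) > 0} else - {z. Im (cis (- \<gamma>) * z) > 0})"

definition rot :: "real \<Rightarrow> (nat \<Rightarrow> complex) \<Rightarrow> nat \<Rightarrow> complex \<Rightarrow> complex" where
  "rot \<alpha> C j z = cis \<alpha> * (z - C j) + C j"

definition pw_rot :: "real \<Rightarrow> real \<Rightarrow> (nat \<Rightarrow> complex) \<Rightarrow> complex \<Rightarrow> complex" where
  "pw_rot \<alpha> \<gamma> C z = (if z \<in> half_plane \<gamma> 0 then rot \<alpha> C 0 z else rot \<alpha> C 1 z)"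

definition limit_A :: "(complex \<Rightarrow> complex) \<Rightarrow> complex set" where
  "limit_A T = (\<Union>M\<in>{0::real<..}. \<Inter>n. (T ^^ n) ` ball 0 M)"

definition limit_B :: "(complex \<Rightarrow> complex) \<Rightarrow> complex set" where
  "limit_B T = (\<Union>M\<in>{0::real<..}. \<Inter>n. (T ^^ n) -` ball 0 M)"

text \<open>
  The point \<open>z_u\<close>, i.e. the fixed point of \<open>rot \<alpha> C (u ! (n - 1)) \<circ> \<dots> \<circ> rot \<alpha> C (u ! 0)\<close>
  for \<open>n = length u\<close>; it is meaningful only when \<open>cis (n * \<alpha>) \<noteq> 1\<close>.
\<close>

definition word_point :: "real \<Rightarrow> (nat \<Rightarrow> complex) \<Rightarrow> nat list \<Rightarrow> complex" where
  "word_point \<alpha> C u =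
     (1 - cis \<alpha>) / (1 - cis (real (length u) * \<alpha>)) *
     (\<Sum>k<length u. cis (real (length u - k - 1) * \<alpha>) * C (u ! k))"

text \<open>The words \<open>u\<close> that code a periodic point \<open>z_u\<close> of period \<open>length u\<close>.\<close>

definition periodic_words :: "real \<Rightarrow> real \<Rightarrow> (nat \<Rightarrow> complex) \<Rightarrow> nat list set" where
  "periodic_words \<alpha> \<gamma> C =
     {u. length u \<ge> 1 \<and> set u \<subseteq> {0, 1} \<and> cis (real (length u) * \<alpha>) \<noteq> 1 \<and>
         (\<forall>k<length u. (pw_rot \<alpha> \<gamma> C ^^ k) (word_point \<alpha> C u) \<in> half_plane \<gamma> (u ! k))}"

definition weight :: "real \<Rightarrow> real \<Rightarrow> (nat \<Rightarrow> complex) \<Rightarrow> nat list \<Rightarrow> real" where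
  "weight \<alpha> \<gamma> C u =
     Min ((\<lambda>k. infdist ((pw_rot \<alpha> \<gamma> C ^^ k) (word_point \<alpha> C u)) (disc_line \<gamma>)) ` {..<length u})"

end

theory Submission
  imports Defs
begin

text \<open>
  Along the orbit of a periodic point \<open>p\<close>, the disc of radius \<open>w\<close> around \<open>p\<close> never meets the
  discontinuity line, so every iterate \<open>T\<^sup>m\<close> acts on it as a rigid rotation onto the disc of the
  same radius around \<open>T\<^sup>m p\<close>.  Forward orbits therefore stay within \<open>w\<close> of the finite orbit of
  \<open>p\<close>.  As \<open>T\<^sup>m\<^sup>n\<close> rotates the disc onto itself, where \<open>n\<close> is the period, every point of the disc
  also has preimages of all orders within \<open>w\<close> of the orbit of \<open>p\<close>.
\<close>

text \<open>Multiplication by \<open>cis (- \<gamma>)\<close> turns the line into the real axis.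
  Rotating the real part of the image back gives a point of the line at the stated distance.\<close>

lemma infdist_disc_line_le: "infdist q (disc_line \<gamma>) \<le> \<bar>Im (cis (- \<gamma>) * q)\<bar>"
proof -
  define v where "v = cis (- \<gamma>) * q"
  have q: "q = cis \<gamma> * v"
    by (simp add: v_def mult.assoc[symmetric] cis_mult)
  have "infdist q (disc_line \<gamma>) \<le> dist q (cis \<gamma> * of_real (Re v))"
    by (rule infdist_le) (auto simp: disc_line_def)
  also have "\<dots> = norm (cis \<gamma> * (v - of_real (Re v)))"
    by (simp add: dist_norm q algebra_simps)
  also have "\<dots> = \<bar>Im v\<bar>"
    unfolding norm_mult by (simp add: cmod_def)
  finally show ?thesis by (simp add: v_def)
qed

text \<open>Crossing the line would change the rotated imaginary part by at least its absolute value
  at \<open>q\<close>, but that change is bounded by \<open>dist q z\<close>. Strictness also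
  excludes \<open>q\<close> on the line.\<close>

lemma half_plane_0_iff_near:
  assumes "dist q z < infdist q (disc_line \<gamma>)"
  shows "z \<in> half_plane \<gamma> 0 \<longleftrightarrow> q \<in> half_plane \<gamma> 0"
proof -
  have "\<bar>Im (cis (- \<gamma>) * q) - Im (cis (- \<gamma>) * z)\<bar> = \<bar>Im (cis (- \<gamma>) * (q - z))\<bar>"
    by (simp add: algebra_simps)
  also have "\<dots> \<le> norm (cis (- \<gamma>) * (q - z))"
    by (rule abs_Im_le_cmod)
  also have "\<dots> = dist q z"
    by (simp add: norm_mult dist_norm)
  also have "\<dots> < \<bar>Im (cis (- \<gamma>) * q)\<bar>"
    using assms infdist_disc_line_le[of q \<gamma>] by linarith
  finally have "Im (cis (- \<gamma>) * z) > 0 \<longleftrightarrow> Im (cis (- \<gamma>) * q) > 0"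
    by linarith
  then show ?thesis
    by (simp only: half_plane_def mem_Collect_eq if_True refl)
qed

text \<open>On one side of the line the same rotation applies to both points, and its linear part is
  \<open>cis \<alpha>\<close> whichever side it is.\<close>

lemma pw_rot_near:
  assumes "dist q z < infdist q (disc_line \<gamma>)"
  shows "pw_rot \<alpha> \<gamma> C z = pw_rot \<alpha> \<gamma> C q + cis \<alpha> * (z - q)"
proof -
  have "rot \<alpha> C j z = rot \<alpha> C j q + cis \<alpha> * (z - q)" for j
    by (simp only: rot_def algebra_simps)
  then show ?thesis
    unfolding pw_rot_def half_plane_0_iff_near[OF assms] by simp
qed

lemma funpow_pw_rot_near:
  assumes "\<And>k. r \<le> infdist ((pw_rot \<alpha> \<gamma> C ^^ k) p) (disc_line \<gamma>)"
    and "dist p z < r"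
  shows "(pw_rot \<alpha> \<gamma> C ^^ m) z = (pw_rot \<alpha> \<gamma> C ^^ m) p + cis (real m * \<alpha>) * (z - p)"
proof (induction m)
  case 0
  show ?case by simp
next
  case (Suc m)
  have "dist ((pw_rot \<alpha> \<gamma> C ^^ m) p) ((pw_rot \<alpha> \<gamma> C ^^ m) z) = dist p z"
    by (simp add: Suc dist_norm norm_mult norm_minus_commute)
  with assms(2) assms(1)[of m]
  have "dist ((pw_rot \<alpha> \<gamma> C ^^ m) p) ((pw_rot \<alpha> \<gamma> C ^^ m) z)
      < infdist ((pw_rot \<alpha> \<gamma> C ^^ m) p) (disc_line \<gamma>)"
    by linarith
  from pw_rot_near[OF this, of \<alpha> C] show ?case
    by (simp add: Suc mult.assoc[symmetric] cis_mult distrib_right)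
qed

lemma ball_periodic_subset_limit_sets:
  assumes n: "n > 0" and per: "(pw_rot \<alpha> \<gamma> C ^^ n) p = p"
    and r: "\<And>k. k < n \<Longrightarrow> r \<le> infdist ((pw_rot \<alpha> \<gamma> C ^^ k) p) (disc_line \<gamma>)"
  shows "ball p r \<subseteq> limit_B (pw_rot \<alpha> \<gamma> C)" and "ball p r \<subseteq> limit_A (pw_rot \<alpha> \<gamma> C)"
proof -
  define T where "T = pw_rot \<alpha> \<gamma> C"
  have T_mod: "(T ^^ (m mod n)) p = (T ^^ m) p" for m
    using funpow_mod_eq[OF per] by (simp add: T_def)
  \<comment> \<open>Periodicity extends the bound from one period to all iterates.\<close>
  have r': "r \<le> infdist ((T ^^ k) p) (disc_line \<gamma>)" for k
    using r[of "k mod n"] n by (simp add: T_mod flip: T_def)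
  have iter: "(T ^^ m) z = (T ^^ m) p + cis (real m * \<alpha>) * (z - p)" if "z \<in> ball p r" for m z
    unfolding T_def
    by (rule funpow_pw_rot_near[where r = r]) (use r' that in \<open>auto simp flip: T_def\<close>)
  \<comment> \<open>A sum of norms over one period dominates each of its terms, hence the whole
    orbit.\<close>
  define b where "b = (\<Sum>k<n. norm ((T ^^ k) p))"
  have orbit: "norm ((T ^^ m) p) \<le> b" for m
  proof -
    have "norm ((T ^^ (m mod n)) p) \<le> b"
      unfolding b_def by (rule member_le_sum) (use n in auto)
    then show ?thesis by (simp add: T_mod)
  qed
  have b: "0 \<le> b" unfolding b_def by (rule sum_nonneg) auto
  have bounded: "(T ^^ m) z \<in> ball 0 (b + r)" if "z \<in> ball p r" for m z
  proof -
    have "norm ((T ^^ m) z) \<le> norm ((T ^^ m) p) + norm (z - p)"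
      unfolding iter[OF that] by (rule norm_triangle_le) (simp add: norm_mult)
    also have "\<dots> < b + r"
      using orbit[of m] that by (simp add: dist_norm norm_minus_commute)
    finally show ?thesis by simp
  qed
  \<comment> \<open>The radius may be nonpositive in general; a point of the ball forces
    \<open>r > 0\<close>.\<close>
  have pos: "b + r > 0" if "z \<in> ball p r" for z
    using b zero_le_dist[of p z] that unfolding mem_ball by linarith
  show "ball p r \<subseteq> limit_B (pw_rot \<alpha> \<gamma> C)"
    using bounded pos unfolding limit_B_def T_def[symmetric] by blast
  have "z \<in> (T ^^ m) ` ball 0 (b + r)" if z: "z \<in> ball p r" for m z
  proof -
    \<comment> \<open>A multiple of the period that is at least \<open>m\<close>:
      \<open>T ^^ N\<close> fixes \<open>p\<close>, so it turns the disc about its centre by the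
      angle \<open>N * \<alpha>\<close>. Undoing this turn gives \<open>y\<close>, and
      \<open>(T ^^ (N - m)) y\<close> is the bounded preimage of \<open>z\<close> under
      \<open>T ^^ m\<close>.\<close>
    define N where "N = m * n"
    have N: "m \<le> N" using n by (simp add: N_def)
    define y where "y = p + cis (- (real N * \<alpha>)) * (z - p)"
    have y: "y \<in> ball p r"
      using z by (simp add: y_def dist_norm norm_mult norm_minus_commute)
    have "(T ^^ N) p = p"
      using T_mod[of N] by (simp add: N_def)
    then have "(T ^^ N) y = z"
      unfolding iter[OF y] by (simp add: y_def mult.assoc[symmetric] cis_mult)
    then have "(T ^^ m) ((T ^^ (N - m)) y) = z"
      using N by (metis comp_apply funpow_add le_add_diff_inverse)
    with bounded[OF y] show ?thesis by (metis imageI)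
  qed
  then show "ball p r \<subseteq> limit_A (pw_rot \<alpha> \<gamma> C)"
    using pos unfolding limit_A_def T_def[symmetric] by blast
qed

text \<open>Unrolls the affine recursion \<open>q\<close> to
  \<open>cis \<alpha> * q + (1 - cis \<alpha>) * C (u ! m)\<close>. At \<open>m = length u\<close>
  the sum is the one in \<open>word_point\<close>.\<close>

lemma funpow_pw_rot_coded:
  assumes "set u \<subseteq> {0, 1}"
    and "\<And>k. k < length u \<Longrightarrow> (pw_rot \<alpha> \<gamma> C ^^ k) p \<in> half_plane \<gamma> (u ! k)"
    and "m \<le> length u"
  shows "(pw_rot \<alpha> \<gamma> C ^^ m) p = cis (real m * \<alpha>) * p
    + (1 - cis \<alpha>) * (\<Sum>k<m. cis (real (m - k - 1) * \<alpha>) * C (u ! k))"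
  using assms(3)
proof (induction m)
  case 0
  show ?case by simp
next
  case (Suc m)
  then have m: "m < length u" by simp
  define q where "q = (pw_rot \<alpha> \<gamma> C ^^ m) p"
  \<comment> \<open>\<open>half_plane\<close> treats all nonzero letters alike, whereas
    \<open>rot\<close> reads \<open>C\<close> at the letter itself, so the letter must be 0 or
    1.\<close>
  have "u ! m \<in> {0, 1}" using assms(1) nth_mem[OF m] by blast
  with assms(2)[OF m] have step: "pw_rot \<alpha> \<gamma> C q = rot \<alpha> C (u ! m) q"
    by (auto simp: q_def pw_rot_def half_plane_def)
  have "cis \<alpha> * (\<Sum>k<m. cis (real (m - k - 1) * \<alpha>) * C (u ! k))
      = (\<Sum>k<m. cis (real (Suc m - k - 1) * \<alpha>) * C (u ! k))"
    unfolding sum_distrib_left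
  proof (rule sum.cong[OF refl])
    \<comment> \<open>The bound \<open>k < m\<close> keeps the natural subtraction in
      \<open>m - k - 1\<close> from truncating.\<close>
    fix k assume "k \<in> {..<m}"
    then have "real (Suc m - k - 1) * \<alpha> = \<alpha> + real (m - k - 1) * \<alpha>"
      by (simp add: of_nat_diff algebra_simps)
    then show "cis \<alpha> * (cis (real (m - k - 1) * \<alpha>) * C (u ! k))
        = cis (real (Suc m - k - 1) * \<alpha>) * C (u ! k)"
      by (simp only: cis_mult[symmetric] mult.assoc)
  qed
  \<comment> \<open>The new summand \<open>k = m\<close> has exponent 0, so \<open>C (u ! m)\<close>
    appears without a factor.\<close>
  then have sum: "(\<Sum>k<Suc m. cis (real (Suc m - k - 1) * \<alpha>) * C (u ! k))
      = cis \<alpha> * (\<Sum>k<m. cis (real (m - k - 1) * \<alpha>) * C (u ! k)) + C (u ! m)"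
    by simp
  have cis: "cis (real (Suc m) * \<alpha>) = cis \<alpha> * cis (real m * \<alpha>)"
    by (simp add: cis_mult distrib_right)
  have q: "q = cis (real m * \<alpha>) * p
      + (1 - cis \<alpha>) * (\<Sum>k<m. cis (real (m - k - 1) * \<alpha>) * C (u ! k))"
    unfolding q_def using Suc by simp
  have "(pw_rot \<alpha> \<gamma> C ^^ Suc m) p = cis \<alpha> * q + (1 - cis \<alpha>) * C (u ! m)"
    using step by (simp add: q_def rot_def algebra_simps)
  then show ?case
    unfolding sum cis q by (simp only: algebra_simps)
qed

text \<open>The coded iterate is \<open>z\<close> to \<open>c * z + (1 - cis \<alpha>) * s\<close>;
  since \<open>c\<close> differs from 1, solving for its fixed point gives exactly the formula of
  \<open>word_point\<close>.\<close>

lemma funpow_word_point: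
  assumes "u \<in> periodic_words \<alpha> \<gamma> C"
  shows "(pw_rot \<alpha> \<gamma> C ^^ length u) (word_point \<alpha> C u) = word_point \<alpha> C u"
proof -
  define c where "c = cis (real (length u) * \<alpha>)"
  define s where "s = (\<Sum>k<length u. cis (real (length u - k - 1) * \<alpha>) * C (u ! k))"
  have c: "c \<noteq> 1"
    using assms by (simp add: periodic_words_def c_def)
  have wp: "word_point \<alpha> C u = (1 - cis \<alpha>) / (1 - c) * s"
    by (simp add: word_point_def c_def s_def)
  have "(pw_rot \<alpha> \<gamma> C ^^ length u) (word_point \<alpha> C u) = c * word_point \<alpha> C u + (1 - cis \<alpha>) * s"
    unfolding c_def s_def
    by (rule funpow_pw_rot_coded) (use assms in \<open>auto simp: periodic_words_def\<close>)
  also have "(1 - cis \<alpha>) * s = (1 - c) * word_point \<alpha> C u"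
    using c by (simp add: wp)
  finally show ?thesis by (simp add: algebra_simps)
qed

theorem proposition19:
  fixes \<alpha> \<gamma> :: real and C :: "nat \<Rightarrow> complex"
  assumes "cis \<alpha> \<noteq> 1" and "C 0 \<noteq> C 1"
  shows "(\<Union>u\<in>periodic_words \<alpha> \<gamma> C. ball (word_point \<alpha> C u) (weight \<alpha> \<gamma> C u))
           \<subseteq> limit_B (pw_rot \<alpha> \<gamma> C) \<and>
         (\<Union>u\<in>periodic_words \<alpha> \<gamma> C. ball (word_point \<alpha> C u) (weight \<alpha> \<gamma> C u))
           \<subseteq> limit_A (pw_rot \<alpha> \<gamma> C)"
proof -
  have "ball (word_point \<alpha> C u) (weight \<alpha> \<gamma> C u) \<subseteq> limit_B (pw_rot \<alpha> \<gamma> C) \<and>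
        ball (word_point \<alpha> C u) (weight \<alpha> \<gamma> C u) \<subseteq> limit_A (pw_rot \<alpha> \<gamma> C)"
    if u: "u \<in> periodic_words \<alpha> \<gamma> C" for u
  proof -
    have "0 < length u" using u by (auto simp: periodic_words_def)
    moreover have "weight \<alpha> \<gamma> C u
        \<le> infdist ((pw_rot \<alpha> \<gamma> C ^^ k) (word_point \<alpha> C u)) (disc_line \<gamma>)"
      if "k < length u" for k
      unfolding weight_def by (rule Min_le) (use that in auto)
    ultimately show ?thesis
      using ball_periodic_subset_limit_sets[OF _ funpow_word_point[OF u]] by blast
  qed
  then show ?thesis by blast
qed

end
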